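(* Let $L\ge0$, $\gamma\ge0$, $\beta\ge0$ and $h>0$, and set $$M_h=\begin{pmatrix}A_h&-Lh\beta/2\\-Lh\beta/2&C_h\end{pmatrix},\qquad A_h=h\gamma-\frac{Lh^2}{2},\qquad C_h=\frac12+\frac{\beta}{h}+\frac{\beta\gamma}{2}-\frac{L\beta^2}{2}.$$ For $L>0$, $\gamma>0$ define $$h_{\mathrm{Lyap}}=\frac{\gamma-L\beta+\sqrt{(\gamma-L\beta)^2+4L\beta\gamma/(1+\beta\gamma)}}{L}.$$ (i) If $L>0$ and $\gamma>0$, then $M_h\succeq0$ if and only if $0<h\le h_{\mathrm{Lyap}}$, and $M_h\succ0$ if and only if $0<h<h_{\mathrm{Lyap}}$. For $\beta=0$ one has $h_{\mathrm{Lyap}}=2\gamma/L$. (ii) If $L=0$ and $\gamma>0$, then $M_h\succ0$ for every $h>0$. (iii) If $L=\gamma=0$, then $M_h\succeq0$ but $M_h\not\succ0$ for every $h>0$. (iv) If $\gamma=0<L$, then $M_h\not\succeq0$ for every $h>0$.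
   Context: $M\succeq0$ (resp. $M\succ0$) means that the real symmetric matrix $M$ is positive semidefinite (resp. positive definite). *)

theory Defs
  imports "HOL-Analysis.Analysis"
begin

definition pos_semidef :: "real ^ 'n ^ 'n \<Rightarrow> bool" where
  "pos_semidef M \<longleftrightarrow> transpose M = M \<and> (\<forall>x. 0 \<le> x \<bullet> (M *v x))"

definition pos_def :: "real ^ 'n ^ 'n \<Rightarrow> bool" where
  "pos_def M \<longleftrightarrow> transpose M = M \<and> (\<forall>x. x \<noteq> 0 \<longrightarrow> 0 < x \<bullet> (M *v x))"

definition A_entry :: "real \<Rightarrow> real \<Rightarrow> real \<Rightarrow> real" where
  "A_entry L \<gamma> h = h * \<gamma> - L * h\<^sup>2 / 2"

definition C_entry :: "real \<Rightarrow> real \<Rightarrow> real \<Rightarrow> real \<Rightarrow> real" where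
  "C_entry L \<gamma> \<beta> h = 1 / 2 + \<beta> / h + \<beta> * \<gamma> / 2 - L * \<beta>\<^sup>2 / 2"

definition M_mat :: "real \<Rightarrow> real \<Rightarrow> real \<Rightarrow> real \<Rightarrow> real ^ 2 ^ 2" where
  "M_mat L \<gamma> \<beta> h =
     vector [vector [A_entry L \<gamma> h,      - (L * h * \<beta> / 2)],
             vector [- (L * h * \<beta> / 2), C_entry L \<gamma> \<beta> h]]"

(* Only meaningful for L > 0 and \<gamma> > 0; for L = 0 the division by zero yields the value 0. *)
definition h_Lyap :: "real \<Rightarrow> real \<Rightarrow> real \<Rightarrow> real" where
  "h_Lyap L \<gamma> \<beta> =
     (\<gamma> - L * \<beta> + sqrt ((\<gamma> - L * \<beta>)\<^sup>2 + 4 * L * \<beta> * \<gamma> / (1 + \<beta> * \<gamma>))) / L"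

end

theory Submission
  imports Defs
begin

text \<open>The determinant of \<open>M\<^sub>h\<close> is a concave quadratic in \<open>h\<close> whose roots are \<open>h_Lyap\<close> and a
  nonpositive number, so for \<open>h > 0\<close> it has the sign of \<open>h_Lyap - h\<close>. At \<open>h = 2\<gamma>/L\<close> the entry
  \<open>A\<^sub>h\<close> vanishes and the determinant is at most \<open>0\<close>, so \<open>h_Lyap \<le> 2\<gamma>/L\<close>; hence \<open>A\<^sub>h\<close> is
  positive before \<open>h_Lyap\<close>, and the determinant alone decides definiteness.\<close>

lemma symmetric_matrix_2: "transpose (vector [vector [a, b], vector [b, c]] :: real ^ 2 ^ 2) =
    vector [vector [a, b], vector [b, c]]"
  by (simp add: vec_eq_iff transpose_def forall_2)

lemma quadratic_form_2:
  fixes x :: "real ^ 2"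
  shows "x \<bullet> ((vector [vector [a, b], vector [b, c]] :: real ^ 2 ^ 2) *v x) =
    a * (x $ 1)\<^sup>2 + 2 * b * (x $ 1) * (x $ 2) + c * (x $ 2)\<^sup>2"
  by (simp add: inner_vec_def matrix_vector_mult_def sum_2 power2_eq_square algebra_simps)

text \<open>Completing the square: \<open>a\<close> times the form is
  \<open>(a * s + b * t)\<^sup>2 + (a * c - b\<^sup>2) * t\<^sup>2\<close>. This decides the sign
  only when \<open>a\<close> is nonzero, so \<open>a = 0\<close> is handled apart in both
  directions; there the discriminant condition collapses to \<open>b = 0\<close>.\<close>

lemma pos_semidef_2_iff:
  "pos_semidef (vector [vector [a, b], vector [b, c]] :: real ^ 2 ^ 2) \<longleftrightarrow>
    0 \<le> a \<and> 0 \<le> c \<and> b\<^sup>2 \<le> a * c"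
proof -
  have "(\<forall>x :: real ^ 2. 0 \<le> a * (x $ 1)\<^sup>2 + 2 * b * (x $ 1) * (x $ 2) + c * (x $ 2)\<^sup>2) \<longleftrightarrow>
      0 \<le> a \<and> 0 \<le> c \<and> b\<^sup>2 \<le> a * c" (is "(\<forall>x. ?q x) \<longleftrightarrow> ?R")
  proof
    assume q: "\<forall>x. ?q x"
    have Q: "0 \<le> a * s\<^sup>2 + 2 * b * s * t + c * t\<^sup>2" for s t
      using q[rule_format, of "vector [s, t]"] by simp
    have a: "0 \<le> a" and c: "0 \<le> c" using Q[of 1 0] Q[of 0 1] by simp_all
    have "b\<^sup>2 \<le> a * c"
    proof (cases "a = 0")
      case True
      have "b = 0"
      proof (rule ccontr)
        assume "b \<noteq> 0"
        \<comment> \<open>With \<open>a = 0\<close> and \<open>t = 1\<close> the form is affine in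
          \<open>s\<close> with slope \<open>2 * b\<close>; this \<open>s\<close> is chosen to give
          it the value -1.\<close>
        then show False
          using Q[of "- (c + 1) / (2 * b)" 1] True by (simp add: field_simps)
      qed
      then show ?thesis using True by simp
    next
      case False
      \<comment> \<open>At \<open>s = - b\<close>, \<open>t = a\<close> the completed square
        vanishes and only the determinant term remains.\<close>
      have "0 \<le> a * (a * c - b\<^sup>2)"
        using Q[of "- b" a] by (simp add: power2_eq_square algebra_simps)
      then show ?thesis using a False by (simp add: zero_le_mult_iff)
    qed
    then show ?R using a c by simp
  next
    assume R: ?R
    show "\<forall>x. ?q x"
    proof
      fix x :: "real ^ 2"
      show "?q x"
      proof (cases "a = 0")
        case True
        then show ?thesis using R by simp
      next
        case False
        have "0 \<le> (a * x $ 1 + b * x $ 2)\<^sup>2 + (a * c - b\<^sup>2) * (x $ 2)\<^sup>2"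
          using R by simp
        also have "\<dots> = a * (a * (x $ 1)\<^sup>2 + 2 * b * (x $ 1) * (x $ 2) + c * (x $ 2)\<^sup>2)"
          by (simp add: power2_eq_square algebra_simps)
        finally show ?thesis using R False by (simp add: zero_le_mult_iff)
      qed
    qed
  qed
  then show ?thesis
    by (simp add: pos_semidef_def symmetric_matrix_2 quadratic_form_2)
qed

text \<open>The same completed square, now with \<open>a > 0\<close> throughout: the first basis
  vector forces it. No sign condition on \<open>c\<close> is listed, because \<open>a > 0\<close>
  and \<open>b\<^sup>2 < a * c\<close> already give \<open>c > 0\<close>.\<close>

lemma pos_def_2_iff:
  "pos_def (vector [vector [a, b], vector [b, c]] :: real ^ 2 ^ 2) \<longleftrightarrow> 0 < a \<and> b\<^sup>2 < a * c"
proof -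
  have "(\<forall>x :: real ^ 2. x \<noteq> 0 \<longrightarrow>
        0 < a * (x $ 1)\<^sup>2 + 2 * b * (x $ 1) * (x $ 2) + c * (x $ 2)\<^sup>2) \<longleftrightarrow>
      0 < a \<and> b\<^sup>2 < a * c" (is "(\<forall>x. x \<noteq> 0 \<longrightarrow> ?q x) \<longleftrightarrow> ?R")
  proof
    assume q: "\<forall>x. x \<noteq> 0 \<longrightarrow> ?q x"
    have Q: "0 < a * s\<^sup>2 + 2 * b * s * t + c * t\<^sup>2" if "s \<noteq> 0 \<or> t \<noteq> 0" for s t
      using q[rule_format, of "vector [s, t]"] that by (auto simp: vec_eq_iff forall_2)
    have a: "0 < a" using Q[of 1 0] by simp
    have "0 < a * (a * c - b\<^sup>2)"
      using Q[of "- b" a] a by (simp add: power2_eq_square algebra_simps)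
    then show ?R using a by (simp add: zero_less_mult_iff)
  next
    assume R: ?R
    show "\<forall>x. x \<noteq> 0 \<longrightarrow> ?q x"
    proof (intro allI impI)
      fix x :: "real ^ 2"
      assume x: "x \<noteq> 0"
      have "0 < (a * x $ 1 + b * x $ 2)\<^sup>2 + (a * c - b\<^sup>2) * (x $ 2)\<^sup>2"
      proof (cases "x $ 2 = 0")
        case True
        then have "x $ 1 \<noteq> 0" using x by (simp add: vec_eq_iff forall_2)
        then show ?thesis using True R by simp
      next
        case False
        then show ?thesis using R by (intro add_nonneg_pos) simp_all
      qed
      also have "\<dots> = a * (a * (x $ 1)\<^sup>2 + 2 * b * (x $ 1) * (x $ 2) + c * (x $ 2)\<^sup>2)"
        by (simp add: power2_eq_square algebra_simps)
      finally show "?q x" using R by (simp add: zero_less_mult_iff)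
    qed
  qed
  then show ?thesis
    by (simp add: pos_def_def symmetric_matrix_2 quadratic_form_2)
qed

definition det_M :: "real \<Rightarrow> real \<Rightarrow> real \<Rightarrow> real \<Rightarrow> real" where
  "det_M L \<gamma> \<beta> h = A_entry L \<gamma> h * C_entry L \<gamma> \<beta> h - (L * h * \<beta> / 2)\<^sup>2"

lemma pos_semidef_M_mat_iff:
  "pos_semidef (M_mat L \<gamma> \<beta> h) \<longleftrightarrow>
    0 \<le> A_entry L \<gamma> h \<and> 0 \<le> C_entry L \<gamma> \<beta> h \<and> 0 \<le> det_M L \<gamma> \<beta> h"
  by (simp add: M_mat_def pos_semidef_2_iff det_M_def)

lemma pos_def_M_mat_iff:
  "pos_def (M_mat L \<gamma> \<beta> h) \<longleftrightarrow> 0 < A_entry L \<gamma> h \<and> 0 < det_M L \<gamma> \<beta> h"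
  by (simp add: M_mat_def pos_def_2_iff det_M_def)

lemma A_entry_factor: "A_entry L \<gamma> h = h * (2 * \<gamma> - L * h) / 2"
  by (simp add: A_entry_def power2_eq_square algebra_simps)

text \<open>In the variable \<open>L * h\<close> the determinant is a quadratic with roots
  \<open>d + s = L * h_Lyap L \<gamma> \<beta>\<close> and \<open>d - s\<close>. The factor
  belonging to the second root is positive and is absorbed into \<open>r\<close>, so strict and weak
  signs can both be read off.\<close>

lemma det_M_factor:
  assumes "0 < L" "0 < \<gamma>" "0 \<le> \<beta>" "0 < h"
  obtains r where "0 < r" "det_M L \<gamma> \<beta> h = r * (h_Lyap L \<gamma> \<beta> - h)"
proof -
  define d where "d = \<gamma> - L * \<beta>"
  define e where "e = 1 + \<beta> * \<gamma>"
  define s where "s = sqrt (d\<^sup>2 + 4 * L * \<beta> * \<gamma> / e)"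
  have e: "0 < e" using assms by (simp add: e_def add_pos_nonneg)
  have k: "0 \<le> 4 * L * \<beta> * \<gamma> / e" using assms e by simp
  have s2: "s\<^sup>2 = d\<^sup>2 + 4 * L * \<beta> * \<gamma> / e" using k by (simp add: s_def)
  \<comment> \<open>The radicand is at least \<open>d\<^sup>2\<close>, which places the root
    \<open>d - s\<close> at or below 0, hence strictly below \<open>L * h\<close>.\<close>
  have "\<bar>d\<bar> \<le> s" unfolding s_def using k by (intro real_le_rsqrt) simp
  then have pos: "0 < L * h + s - d" using assms mult_pos_pos[of L h] by linarith
  have lyap: "L * h_Lyap L \<gamma> \<beta> = d + s"
    using assms by (simp add: h_Lyap_def d_def e_def s_def)
  have "4 * L * det_M L \<gamma> \<beta> h = e * ((d + s - L * h) * (L * h + s - d))"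
  proof -
    \<comment> \<open>The factor \<open>h\<close> of \<open>A_entry\<close> cancels the pole
      \<beta>/h of \<open>C_entry\<close>, and the terms in \<open>(L * h * \<beta>)\<^sup>2\<close>
      cancel against the squared off-diagonal entry, so the degree in \<open>h\<close> is only
      two.\<close>
    have "4 * L * det_M L \<gamma> \<beta> h =
        4 * L * \<beta> * \<gamma> + 2 * L * h * (1 + \<beta> * \<gamma>) * (\<gamma> - L * \<beta>) - (L * h)\<^sup>2 * (1 + \<beta> * \<gamma>)"
      using assms(4) by (simp add: det_M_def A_entry_def C_entry_def field_simps power2_eq_square)
    also have "\<dots> = 4 * L * \<beta> * \<gamma> + e * (2 * L * h * d - (L * h)\<^sup>2)"
      by (simp add: d_def e_def algebra_simps)
    \<comment> \<open>Rewriting the constant term this way turns the sum into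
      \<open>e * (s\<^sup>2 - (L * h - d)\<^sup>2)\<close>, a difference of squares.\<close>
    also have "4 * L * \<beta> * \<gamma> = e * (s\<^sup>2 - d\<^sup>2)" using s2 e by simp
    finally show ?thesis by (simp add: algebra_simps power2_eq_square)
  qed
  also have "\<dots> = 4 * L * ((e * (L * h + s - d) / 4) * (h_Lyap L \<gamma> \<beta> - h))"
    unfolding lyap[symmetric] by (simp add: algebra_simps)
  finally have "det_M L \<gamma> \<beta> h = e * (L * h + s - d) / 4 * (h_Lyap L \<gamma> \<beta> - h)"
    using assms(1) by simp
  moreover have "0 < e * (L * h + s - d) / 4" using e pos by simp
  ultimately show thesis using that by blast
qed

lemma det_M_sign:
  assumes "0 < L" "0 < \<gamma>" "0 \<le> \<beta>" "0 < h"
  shows "0 \<le> det_M L \<gamma> \<beta> h \<longleftrightarrow> h \<le> h_Lyap L \<gamma> \<beta>" "0 < det_M L \<gamma> \<beta> h \<longleftrightarrow> h < h_Lyap L \<gamma> \<beta>"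
proof -
  obtain r where "0 < r" "det_M L \<gamma> \<beta> h = r * (h_Lyap L \<gamma> \<beta> - h)"
    using det_M_factor[OF assms] .
  then show "0 \<le> det_M L \<gamma> \<beta> h \<longleftrightarrow> h \<le> h_Lyap L \<gamma> \<beta>" "0 < det_M L \<gamma> \<beta> h \<longleftrightarrow> h < h_Lyap L \<gamma> \<beta>"
    by (simp_all add: zero_le_mult_iff zero_less_mult_iff)
qed

lemma h_Lyap_le:
  assumes "0 < L" "0 < \<gamma>" "0 \<le> \<beta>"
  shows "h_Lyap L \<gamma> \<beta> \<le> 2 * \<gamma> / L"
proof -
  \<comment> \<open>Testing the determinant at the zero of \<open>A_entry\<close> bounds
    \<open>h_Lyap\<close> without estimating its square root.\<close>
  have "A_entry L \<gamma> (2 * \<gamma> / L) = 0" using assms by (simp add: A_entry_factor)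
  then have "\<not> 0 < det_M L \<gamma> \<beta> (2 * \<gamma> / L)" by (simp add: det_M_def)
  then show ?thesis using det_M_sign(2)[of L \<gamma> \<beta> "2 * \<gamma> / L"] assms by simp
qed

lemma pos_semidef_M_mat_iff_le_h_Lyap:
  assumes "0 < L" "0 < \<gamma>" "0 \<le> \<beta>" "0 < h"
  shows "pos_semidef (M_mat L \<gamma> \<beta> h) \<longleftrightarrow> h \<le> h_Lyap L \<gamma> \<beta>"
proof
  assume "h \<le> h_Lyap L \<gamma> \<beta>"
  then have det: "0 \<le> det_M L \<gamma> \<beta> h" and "h \<le> 2 * \<gamma> / L"
    using det_M_sign(1)[OF assms] h_Lyap_le[OF assms(1-3)] by auto
  then have A: "0 \<le> A_entry L \<gamma> h"
    using assms by (simp add: A_entry_factor field_simps)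
  \<comment> \<open>If \<open>A_entry\<close> is positive, the sign comes from the product of the
    diagonal entries dominating a square. If it is zero, the determinant is minus a square, so its
    nonnegativity forces \<open>\<beta> = 0\<close> and \<open>C_entry\<close> equals 1/2.\<close>
  have "0 \<le> C_entry L \<gamma> \<beta> h"
  proof (cases "A_entry L \<gamma> h = 0")
    case True
    then have "\<beta> = 0" using det assms by (simp add: det_M_def)
    then show ?thesis by (simp add: C_entry_def)
  next
    case False
    have "0 \<le> (L * h * \<beta> / 2)\<^sup>2" by simp
    also have "\<dots> \<le> A_entry L \<gamma> h * C_entry L \<gamma> \<beta> h" using det by (simp add: det_M_def)
    finally show ?thesis using A False by (simp add: zero_le_mult_iff)
  qed
  then show "pos_semidef (M_mat L \<gamma> \<beta> h)" using A det by (simp add: pos_semidef_M_mat_iff)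
qed (simp add: pos_semidef_M_mat_iff det_M_sign(1)[OF assms])

lemma pos_def_M_mat_iff_less_h_Lyap:
  assumes "0 < L" "0 < \<gamma>" "0 \<le> \<beta>" "0 < h"
  shows "pos_def (M_mat L \<gamma> \<beta> h) \<longleftrightarrow> h < h_Lyap L \<gamma> \<beta>"
proof
  assume h: "h < h_Lyap L \<gamma> \<beta>"
  then have "h < 2 * \<gamma> / L" using h_Lyap_le[OF assms(1-3)] by simp
  then have "0 < A_entry L \<gamma> h" using assms by (simp add: A_entry_factor field_simps)
  then show "pos_def (M_mat L \<gamma> \<beta> h)"
    using h by (simp add: pos_def_M_mat_iff det_M_sign(2)[OF assms])
qed (simp add: pos_def_M_mat_iff det_M_sign(2)[OF assms])

text \<open>The only subtracted term carries the factor \<open>L\<close>. For \<open>L = 0\<close>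
  the matrix is diagonal with first entry \<open>h * \<gamma>\<close>, so this reduces that case to
  whether \<gamma> is positive or zero.\<close>

lemma C_entry_pos:
  assumes "0 \<le> \<gamma>" "0 \<le> \<beta>" "0 < h"
  shows "0 < C_entry 0 \<gamma> \<beta> h"
  using assms by (simp add: C_entry_def add_pos_nonneg)

theorem theorem4p4:
  fixes L \<gamma> \<beta> :: real
  assumes "0 \<le> L" and "0 \<le> \<gamma>" and "0 \<le> \<beta>"
  shows
    "(0 < L \<and> 0 < \<gamma> \<longrightarrow>
        (\<forall>h>0. (pos_semidef (M_mat L \<gamma> \<beta> h) \<longleftrightarrow> 0 < h \<and> h \<le> h_Lyap L \<gamma> \<beta>) \<and>
               (pos_def (M_mat L \<gamma> \<beta> h) \<longleftrightarrow> 0 < h \<and> h < h_Lyap L \<gamma> \<beta>)) \<and>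
        (\<beta> = 0 \<longrightarrow> h_Lyap L \<gamma> \<beta> = 2 * \<gamma> / L)) \<and>
     (L = 0 \<and> 0 < \<gamma> \<longrightarrow> (\<forall>h>0. pos_def (M_mat L \<gamma> \<beta> h))) \<and>
     (L = 0 \<and> \<gamma> = 0 \<longrightarrow>
        (\<forall>h>0. pos_semidef (M_mat L \<gamma> \<beta> h) \<and> \<not> pos_def (M_mat L \<gamma> \<beta> h))) \<and>
     (\<gamma> = 0 \<and> 0 < L \<longrightarrow> (\<forall>h>0. \<not> pos_semidef (M_mat L \<gamma> \<beta> h)))"
proof (intro conjI impI allI)
  show "\<And>h. 0 < L \<and> 0 < \<gamma> \<Longrightarrow> 0 < h \<Longrightarrow>
      pos_semidef (M_mat L \<gamma> \<beta> h) \<longleftrightarrow> 0 < h \<and> h \<le> h_Lyap L \<gamma> \<beta>"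
    using assms by (simp add: pos_semidef_M_mat_iff_le_h_Lyap)
  show "\<And>h. 0 < L \<and> 0 < \<gamma> \<Longrightarrow> 0 < h \<Longrightarrow>
      pos_def (M_mat L \<gamma> \<beta> h) \<longleftrightarrow> 0 < h \<and> h < h_Lyap L \<gamma> \<beta>"
    using assms by (simp add: pos_def_M_mat_iff_less_h_Lyap)
  show "0 < L \<and> 0 < \<gamma> \<Longrightarrow> \<beta> = 0 \<Longrightarrow> h_Lyap L \<gamma> \<beta> = 2 * \<gamma> / L"
    by (simp add: h_Lyap_def)
  show "\<And>h. L = 0 \<and> 0 < \<gamma> \<Longrightarrow> 0 < h \<Longrightarrow> pos_def (M_mat L \<gamma> \<beta> h)"
    using assms C_entry_pos by (simp add: pos_def_M_mat_iff det_M_def A_entry_def)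
  show "\<And>h. L = 0 \<and> \<gamma> = 0 \<Longrightarrow> 0 < h \<Longrightarrow> pos_semidef (M_mat L \<gamma> \<beta> h)"
    using assms C_entry_pos[of 0 \<beta>, THEN less_imp_le]
    by (simp add: pos_semidef_M_mat_iff det_M_def A_entry_def)
  show "\<And>h. L = 0 \<and> \<gamma> = 0 \<Longrightarrow> 0 < h \<Longrightarrow> \<not> pos_def (M_mat L \<gamma> \<beta> h)"
    by (simp add: pos_def_M_mat_iff A_entry_def)
  \<comment> \<open>Here the upper left entry is \<open>- (L * h\<^sup>2 / 2)\<close>, which is
    negative.\<close>
  show "\<And>h. \<gamma> = 0 \<and> 0 < L \<Longrightarrow> 0 < h \<Longrightarrow> \<not> pos_semidef (M_mat L \<gamma> \<beta> h)"
    by (simp add: pos_semidef_M_mat_iff A_entry_def mult_le_0_iff)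
qed

end
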